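(* Let $G$ be a finite connected undirected loopless multigraph with vertices $v_0,\dots,v_n$ and sink $v_0$, let $H$ be a hereditary chip-firing model on $G$, and let $D$ be a chip-firing configuration on $G$. Then the stabilization of $D$ is independent of the firings chosen: if two sequences of firings of sets of $H$, each set being ready at the moment it is fired, both start from $D$ and end in stable configurations, then these two stable configurations are equal.
   Context: A configuration is a function $D:V(G)\to\mathbb Z$. $Q$ is the Laplacian of $G$ (diagonal degree matrix minus adjacency matrix) and $\chi_S$ is the characteristic vector of $S\subset V(G)$. Firing a set $S$ replaces $D$ by $D-Q\chi_S$. A vertex $v$ is in debt in $D$ if $D(v)<0$. The sink $v_0$ never fires during stabilization. A hereditary chip-firing model is a collection $H$ of subsets of $V(G)\setminus\{v_0\}$ such that every $v_i$ with $i\ne0$ lies in some member of $H$, and $B\subset A\in H$ implies $B\in H$. A nonempty set $M\in H$ is ready in $D$ if it can fire without any $v\in M$ being sent into debt, i.e. $(D-Q\chi_M)(v)\ge0$ for all $v\in M$. $D$ is stable if no nonempty $M\in H$ is ready in $D$. Stabilization is the process of firing ready sets from $H$ until the configuration becomes stable. *)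

theory Defs
  imports Main "HOL-Library.FuncSet" "HOL-Library.Indicator_Function"
begin

text \<open>Undirected multigraphs: every edge has its own name and is mapped to the set of its
  endpoints, so parallel edges are distinct edges with the same set of endpoints.\<close>

record ('v, 'e) multigraph =
  verts :: "'v set"
  edges :: "'e set"
  ends :: "'e \<Rightarrow> 'v set"

definition finite_loopless_multigraph :: "('v, 'e) multigraph \<Rightarrow> bool" where
  "finite_loopless_multigraph G \<longleftrightarrow>
     finite (verts G) \<and> finite (edges G) \<and>
     (\<forall>e\<in>edges G. ends G e \<subseteq> verts G \<and> card (ends G e) = 2)"

definition adjacent :: "('v, 'e) multigraph \<Rightarrow> 'v \<Rightarrow> 'v \<Rightarrow> bool" where
  "adjacent G u w \<longleftrightarrow> (\<exists>e\<in>edges G. ends G e = {u, w})"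

definition connected_multigraph :: "('v, 'e) multigraph \<Rightarrow> bool" where
  "connected_multigraph G \<longleftrightarrow>
     verts G \<noteq> {} \<and> (\<forall>u\<in>verts G. \<forall>w\<in>verts G. (adjacent G)\<^sup>*\<^sup>* u w)"

definition degree :: "('v, 'e) multigraph \<Rightarrow> 'v \<Rightarrow> nat" where
  "degree G v = card {e \<in> edges G. v \<in> ends G e}"

definition adjacency :: "('v, 'e) multigraph \<Rightarrow> 'v \<Rightarrow> 'v \<Rightarrow> nat" where
  "adjacency G u w = card {e \<in> edges G. ends G e = {u, w}}"

definition laplacian :: "('v, 'e) multigraph \<Rightarrow> 'v \<Rightarrow> 'v \<Rightarrow> int" where
  "laplacian G u w = (if u = w then int (degree G u) else 0) - int (adjacency G u w)"

text \<open>Configurations are extensional functions on the vertex set, so that equality of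
  configurations is equality on the vertices (the sink included).\<close>

definition configurations :: "('v, 'e) multigraph \<Rightarrow> ('v \<Rightarrow> int) set" where
  "configurations G = verts G \<rightarrow>\<^sub>E UNIV"

definition fire :: "('v, 'e) multigraph \<Rightarrow> 'v set \<Rightarrow> ('v \<Rightarrow> int) \<Rightarrow> ('v \<Rightarrow> int)" where
  "fire G S D = (\<lambda>v\<in>verts G. D v - (\<Sum>w\<in>verts G. laplacian G v w * indicator S w))"

definition hereditary_model :: "('v, 'e) multigraph \<Rightarrow> 'v \<Rightarrow> 'v set set \<Rightarrow> bool" where
  "hereditary_model G v0 H \<longleftrightarrow>
     H \<subseteq> Pow (verts G - {v0}) \<and>
     (\<forall>v\<in>verts G - {v0}. \<exists>A\<in>H. v \<in> A) \<and>
     (\<forall>A\<in>H. \<forall>B. B \<subseteq> A \<longrightarrow> B \<in> H)"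

definition in_debt :: "('v \<Rightarrow> int) \<Rightarrow> 'v \<Rightarrow> bool" where
  "in_debt D v \<longleftrightarrow> D v < 0"

definition ready :: "('v, 'e) multigraph \<Rightarrow> 'v set set \<Rightarrow> ('v \<Rightarrow> int) \<Rightarrow> 'v set \<Rightarrow> bool" where
  "ready G H D M \<longleftrightarrow> M \<in> H \<and> M \<noteq> {} \<and> (\<forall>v\<in>M. \<not> in_debt (fire G M D) v)"

definition stable_configuration :: "('v, 'e) multigraph \<Rightarrow> 'v set set \<Rightarrow> ('v \<Rightarrow> int) \<Rightarrow> bool" where
  "stable_configuration G H D \<longleftrightarrow> (\<nexists>M. ready G H D M)"

fun legal_firings ::
  "('v, 'e) multigraph \<Rightarrow> 'v set set \<Rightarrow> ('v \<Rightarrow> int) \<Rightarrow> 'v set list \<Rightarrow> bool" where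
  "legal_firings G H D [] \<longleftrightarrow> True"
| "legal_firings G H D (M # Ms) \<longleftrightarrow> ready G H D M \<and> legal_firings G H (fire G M D) Ms"

definition fire_all :: "('v, 'e) multigraph \<Rightarrow> 'v set list \<Rightarrow> ('v \<Rightarrow> int) \<Rightarrow> ('v \<Rightarrow> int)" where
  "fire_all G Ms D = fold (fire G) Ms D"

end

(* Least action principle: if f \<ge> 0 is a firing vector leading from D to a stable configuration,
   then no legal sequence fires any vertex v more than f v times. Otherwise look at the first
   set M that violates this bound. The set A of those v in M that exceed f v belongs to H since H
   is hereditary, and firing A after f gives every v in A at least as many chips as the legal
   firing of M did: v has then fired equally often in both processes, and its neighbours at least
   as often after f. So A would be ready in the stable configuration. Applied to both sequences,
   the principle shows that they fire every vertex equally often. *)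
theory Submission imports Defs begin

text \<open>Multiplicities are integers, so that the firings still to be done after
  \<open>M\<close>, namely \<open>f v - indicator M v\<close>, are given by ordinary
  subtraction.\<close>

definition fire_vector :: "('v, 'e) multigraph \<Rightarrow> ('v \<Rightarrow> int) \<Rightarrow> ('v \<Rightarrow> int) \<Rightarrow> ('v \<Rightarrow> int)" where
  "fire_vector G f D = (\<lambda>v\<in>verts G. D v - (\<Sum>w\<in>verts G. laplacian G v w * f w))"

definition firing_count :: "'v set list \<Rightarrow> 'v \<Rightarrow> int" where
  "firing_count Ms v = (\<Sum>M\<leftarrow>Ms. indicator M v)"

lemma firing_count_simps [simp]:
  "firing_count [] v = 0"
  "firing_count (M # Ms) v = indicator M v + firing_count Ms v"
  by (simp_all add: firing_count_def)

lemma firing_count_nonneg: "0 \<le> firing_count Ms v"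
  by (induction Ms) simp_all

lemma fire_eq_fire_vector: "fire G M D = fire_vector G (indicator M) D"
  by (simp add: fire_def fire_vector_def)

lemma fire_vector_fire_vector:
  "fire_vector G f (fire_vector G g D) = fire_vector G (\<lambda>v. f v + g v) D"
  by (auto simp: fire_vector_def restrict_def fun_eq_iff distrib_left sum.distrib)

lemma fire_vector_cong:
  assumes "\<And>v. v \<in> verts G \<Longrightarrow> f v = g v"
  shows "fire_vector G f D = fire_vector G g D"
  by (simp add: fire_vector_def assms cong: sum.cong)

lemma fire_vector_zero:
  assumes "D \<in> configurations G"
  shows "fire_vector G (\<lambda>_. 0) D = D"
  using assms by (auto simp: fire_vector_def configurations_def restrict_def fun_eq_iff PiE_def extensional_def)

lemma fire_vector_in_configurations: "fire_vector G f D \<in> configurations G"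
  by (simp add: fire_vector_def configurations_def)

text \<open>Each firing adds a vector independent of the current configuration, so only the total
  count at each vertex matters. It thus suffices to compare counts.\<close>

lemma fire_all_eq_fire_vector:
  assumes "D \<in> configurations G"
  shows "fire_all G Ms D = fire_vector G (firing_count Ms) D"
  using assms
proof (induction Ms arbitrary: D)
  case Nil
  have "firing_count [] = (\<lambda>_::'a. 0)" by (simp add: fun_eq_iff)
  with Nil show ?case by (simp add: fire_all_def fire_vector_zero)
next
  case (Cons M Ms)
  have "fire_all G (M # Ms) D = fire_all G Ms (fire G M D)"
    by (simp add: fire_all_def)
  also have "\<dots> = fire_vector G (firing_count Ms) (fire G M D)"
    by (rule Cons.IH) (simp add: fire_eq_fire_vector fire_vector_in_configurations)
  also have "\<dots> = fire_vector G (firing_count (M # Ms)) D"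
    unfolding fire_eq_fire_vector fire_vector_fire_vector
    by (rule fire_vector_cong) simp
  finally show ?case .
qed

lemma laplacian_nonpos: "v \<noteq> w \<Longrightarrow> laplacian G v w \<le> 0"
  by (simp add: laplacian_def)

text \<open>Off-diagonal Laplacian entries are nonpositive, so extra firings at other vertices can
  only bring chips to \<open>v\<close>; the diagonal term is the same for both vectors.\<close>

lemma fire_vector_mono:
  assumes "f v = g v" and "\<And>w. w \<in> verts G \<Longrightarrow> g w \<le> f w" and "v \<in> verts G"
  shows "fire_vector G g D v \<le> fire_vector G f D v"
proof -
  have "laplacian G v w * f w \<le> laplacian G v w * g w" if "w \<in> verts G" for w
    using assms that laplacian_nonpos[of v w G]
    by (cases "v = w") (auto intro: mult_left_mono_neg)
  then show ?thesis
    using assms(3) by (simp add: fire_vector_def sum_mono)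
qed

lemma ready_le_stabilizing_vector:
  assumes "hereditary_model G v0 H" and "ready G H D M"
    and "\<And>v. v \<in> verts G \<Longrightarrow> 0 \<le> f v"
    and "stable_configuration G H (fire_vector G f D)"
    and "v \<in> verts G"
  shows "indicator M v \<le> f v"
proof (rule ccontr)
  assume neg: "\<not> indicator M v \<le> f v"
  \<comment> \<open>As \<open>f\<close> is integral and nonnegative on the vertices, the members of
    \<open>M\<close> that exceed \<open>f\<close> are those with \<open>f u = 0\<close>.\<close>
  define A where "A = {u \<in> M. f u = 0}"
  have M: "M \<in> H" "\<And>u. u \<in> M \<Longrightarrow> 0 \<le> fire_vector G (indicator M) D u"
    using assms(2) by (auto simp: ready_def in_debt_def fire_eq_fire_vector)
  have sub: "M \<subseteq> verts G"
    using assms(1) M(1) by (auto simp: hereditary_model_def)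
  have "v \<in> A"
    using neg assms(3)[OF assms(5)] by (cases "v \<in> M") (auto simp: A_def)
  moreover have "A \<in> H"
    using assms(1) M(1) by (auto simp: hereditary_model_def A_def)
  moreover have "0 \<le> fire_vector G (indicator A) (fire_vector G f D) u" if "u \<in> A" for u
  proof -
    have "u \<in> M" "f u = 0" using that by (auto simp: A_def)
    \<comment> \<open>A member of \<open>M\<close> outside \<open>A\<close> has
      \<open>f w \<ge> 1\<close> by integrality; at \<open>u\<close> both sides equal 1, as
      monotonicity requires.\<close>
    have "indicator M w \<le> indicator A w + f w" if "w \<in> verts G" for w
      using assms(3)[OF that] by (cases "w \<in> M"; cases "f w = 0") (auto simp: A_def)
    then have "fire_vector G (indicator M) D u \<le> fire_vector G (\<lambda>w. indicator A w + f w) D u"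
      using \<open>u \<in> A\<close> \<open>u \<in> M\<close> \<open>f u = 0\<close> sub by (intro fire_vector_mono) auto
    with M(2)[OF \<open>u \<in> M\<close>] show ?thesis
      by (simp add: fire_vector_fire_vector)
  qed
  ultimately have "ready G H (fire_vector G f D) A"
    by (auto simp: ready_def in_debt_def fire_eq_fire_vector not_less)
  with assms(4) show False
    by (auto simp: stable_configuration_def)
qed

text \<open>Induction moves \<open>D\<close> and \<open>f\<close> along together: once
  \<open>M\<close> is fired, \<open>f - indicator M\<close> is nonnegative on the vertices by the
  one-step bound and leads to the same stable configuration.\<close>

lemma firing_count_le_stabilizing_vector:
  assumes "hereditary_model G v0 H" and "legal_firings G H D Ms"
    and "\<And>v. v \<in> verts G \<Longrightarrow> 0 \<le> f v"
    and "stable_configuration G H (fire_vector G f D)"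
    and "v \<in> verts G"
  shows "firing_count Ms v \<le> f v"
  using assms(2-4)
proof (induction Ms arbitrary: D f)
  case Nil
  then show ?case using assms(5) by simp
next
  case (Cons M Ms)
  have le: "indicator M u \<le> f u" if "u \<in> verts G" for u
    using Cons.prems that by (intro ready_le_stabilizing_vector[OF assms(1)]) auto
  have "fire_vector G (\<lambda>u. f u - indicator M u) (fire G M D) = fire_vector G f D"
    by (simp add: fire_eq_fire_vector fire_vector_fire_vector)
  then have "firing_count Ms v \<le> f v - indicator M v"
    using Cons.prems le by (intro Cons.IH) auto
  then show ?case by simp
qed

theorem lemma1:
  fixes G :: "('v, 'e) multigraph" and v0 :: 'v and H :: "'v set set"
    and D :: "'v \<Rightarrow> int" and Ms Ns :: "'v set list"
  assumes "finite_loopless_multigraph G"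
    and "connected_multigraph G"
    and "v0 \<in> verts G"
    and "hereditary_model G v0 H"
    and "D \<in> configurations G"
    and "legal_firings G H D Ms" and "stable_configuration G H (fire_all G Ms D)"
    and "legal_firings G H D Ns" and "stable_configuration G H (fire_all G Ns D)"
  shows "fire_all G Ms D = fire_all G Ns D"
proof -
  note eq = fire_all_eq_fire_vector[OF assms(5)]
  have "firing_count Ms v = firing_count Ns v" if "v \<in> verts G" for v
  proof (rule antisym)
    \<comment> \<open>The count of \<open>Ns\<close> serves as the stabilizing vector
      \<open>f\<close>.\<close>
    show "firing_count Ms v \<le> firing_count Ns v"
      using firing_count_le_stabilizing_vector[OF assms(4) assms(6)] assms(9) that
      by (simp add: eq firing_count_nonneg)
    show "firing_count Ns v \<le> firing_count Ms v"
      using firing_count_le_stabilizing_vector[OF assms(4) assms(8)] assms(7) that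
      by (simp add: eq firing_count_nonneg)
  qed
  then show ?thesis
    unfolding eq by (rule fire_vector_cong)
qed

end
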